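(* Let $n,d,c\geq 1$ and let $f$ be an $n$-bit partial monotone Boolean function. Let $P$ be a protocol of degree $d$ with a conjunction of $c$ inequalities solving $f$, and let $s$ be the size of $P$. Then there exists a protocol of degree $2$ with equality solving $f$ whose size is $\mathcal{O}(sn^{2cd+c-1})$.
   Context: A partial monotone Boolean function $f$ in $n$ variables is given by disjoint sets $f^{-1}(0), f^{-1}(1)\subseteq\{0,1\}^n$ such that whenever $x\in f^{-1}(0)$, $y\in f^{-1}(1)$ there is an index $i$ with $x_i=0$, $y_i=1$. A protocol of degree $d$ with feasibility relation (on $n$ bits) is a directed acyclic graph $G=(V,E)$ together with a relation $F\subseteq\{0,1\}^n\times\{0,1\}^n\times V$ such that (i) $G$ has exactly one source $v_0$ (in-degree zero) and every vertex has out-degree at most $d$; (ii) for every sink $\ell$ (out-degree zero) there is an index $i$ such that for all $x,y\in\{0,1\}^n$, $(x,y,\ell)\in F$ iff $x_i=0$ and $y_i=1$. The protocol solves $f$ if for every $x\in f^{-1}(0)$ and $y\in f^{-1}(1)$: (a) $(x,y,v_0)\in F$; (b) for every vertex $v$ with $p\ge1$ children $u_1,\dots,u_p$, if $(x,y,v)\in F$ then $(x,y,u_i)\in F$ for some $i$. The size of a protocol is its number of vertices. A protocol of degree $d$ with a conjunction of $c$ inequalities is such a protocol where for each vertex $v$ there are functions $q^j_v,r^j_v\colon\{0,1\}^n\to\mathbb{R}$, $j\in\{1,\dots,c\}$, with $(x,y,v)\in F$ iff $q^1_v(x)<r^1_v(y)\wedge\cdots\wedge q^c_v(x)<r^c_v(y)$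 for all $x,y$. A protocol of degree $d$ with equality is one where for each vertex $v$ there are functions $q_v,r_v\colon\{0,1\}^n\to\mathbb{R}$ with $(x,y,v)\in F$ iff $q_v(x)=r_v(y)$ for all $x,y$. The $\mathcal{O}$-notation with several parameters means: $g\in\mathcal{O}(h)$ iff there is $c_0>0$ such that for all values of the parameters $g\le c_0\,h+c_0$. *)

theory Defs
  imports Complex_Main
begin

definition cube :: "nat \<Rightarrow> bool list set" where
  "cube n = {x. length x = n}"

text \<open>
  A partial Boolean function is a map \<open>f\<close> with values \<open>Some False\<close> (for 0) and \<open>Some True\<close> (for 1);
  it is undefined where it is \<open>None\<close>, so its two fibres are automatically disjoint.
\<close>

type_synonym partial_boolfun = "bool list \<Rightarrow> bool option"

definition zeros :: "partial_boolfun \<Rightarrow> bool list set" where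
  "zeros f = f -` {Some False}"

definition ones :: "partial_boolfun \<Rightarrow> bool list set" where
  "ones f = f -` {Some True}"

definition partial_monotone :: "nat \<Rightarrow> partial_boolfun \<Rightarrow> bool" where
  "partial_monotone n f \<longleftrightarrow>
     zeros f \<subseteq> cube n \<and> ones f \<subseteq> cube n \<and>
     (\<forall>x\<in>zeros f. \<forall>y\<in>ones f. \<exists>i<n. \<not> x ! i \<and> y ! i)"

record 'v protocol =
  verts :: "'v set"
  edges :: "('v \<times> 'v) set"
  feasible :: "(bool list \<times> bool list \<times> 'v) set"

definition children :: "'v protocol \<Rightarrow> 'v \<Rightarrow> 'v set" where
  "children P v = edges P `` {v}"

definition is_source :: "'v protocol \<Rightarrow> 'v \<Rightarrow> bool" where
  "is_source P v \<longleftrightarrow> v \<in> verts P \<and> (edges P)\<inverse> `` {v} = {}"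

definition is_sink :: "'v protocol \<Rightarrow> 'v \<Rightarrow> bool" where
  "is_sink P v \<longleftrightarrow> v \<in> verts P \<and> children P v = {}"

definition is_protocol :: "nat \<Rightarrow> nat \<Rightarrow> 'v protocol \<Rightarrow> bool" where
  "is_protocol n d P \<longleftrightarrow>
     finite (verts P) \<and> edges P \<subseteq> verts P \<times> verts P \<and> acyclic (edges P) \<and>
     feasible P \<subseteq> cube n \<times> cube n \<times> verts P \<and>
     (\<exists>!v. is_source P v) \<and>
     (\<forall>v\<in>verts P. card (children P v) \<le> d) \<and>
     (\<forall>l. is_sink P l \<longrightarrow>
        (\<exists>i<n. \<forall>x\<in>cube n. \<forall>y\<in>cube n. (x, y, l) \<in> feasible P \<longleftrightarrow> \<not> x ! i \<and> y ! i))"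

definition solves :: "'v protocol \<Rightarrow> partial_boolfun \<Rightarrow> bool" where
  "solves P f \<longleftrightarrow>
     (\<forall>x\<in>zeros f. \<forall>y\<in>ones f.
        (\<forall>v. is_source P v \<longrightarrow> (x, y, v) \<in> feasible P) \<and>
        (\<forall>v\<in>verts P. children P v \<noteq> {} \<longrightarrow> (x, y, v) \<in> feasible P \<longrightarrow>
           (\<exists>u\<in>children P v. (x, y, u) \<in> feasible P)))"

definition protocol_size :: "'v protocol \<Rightarrow> nat" where
  "protocol_size P = card (verts P)"

definition conj_ineq_protocol :: "nat \<Rightarrow> nat \<Rightarrow> nat \<Rightarrow> 'v protocol \<Rightarrow> bool" where
  "conj_ineq_protocol n d c P \<longleftrightarrow>
     is_protocol n d P \<and>
     (\<forall>v\<in>verts P. \<exists>q r :: nat \<Rightarrow> bool list \<Rightarrow> real. \<forall>x\<in>cube n. \<forall>y\<in>cube n.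
        (x, y, v) \<in> feasible P \<longleftrightarrow> (\<forall>j\<in>{1..c}. q j x < r j y))"

definition equality_protocol :: "nat \<Rightarrow> nat \<Rightarrow> 'v protocol \<Rightarrow> bool" where
  "equality_protocol n d P \<longleftrightarrow>
     is_protocol n d P \<and>
     (\<forall>v\<in>verts P. \<exists>q r :: bool list \<Rightarrow> real. \<forall>x\<in>cube n. \<forall>y\<in>cube n.
        (x, y, v) \<in> feasible P \<longleftrightarrow> q x = r y)"

end

theory Submission
  imports Defs "HOL-Library.Nat_Bijection"
begin

text \<open>
  After replacing real values by ranks, an inequality \<open>q x < r y\<close> compares two numbers of \<open>n + 1\<close> bits.
  It holds iff for some position \<open>t\<close> the bits above \<open>t\<close> agree while bit \<open>t\<close> is 0 in \<open>q x\<close> and 1 in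
  \<open>r y\<close>; for fixed \<open>t\<close> this is an equality condition, and equality conditions are closed under
  conjunction. So a vertex with \<open>c\<close> inequalities splits into \<open>(n + 1) ^ c\<close> equality vertices. To move
  from such a vertex to a child, the at most \<open>c * d\<close> inequalities of all children are compared one
  after the other, scanning each pair of numbers from the top bit down; every intermediate
  condition is again an equality, every step branches at most twice, and the outcome of all
  comparisons singles out a feasible child. The resulting size is \<open>O(s n^c (10 n)^(c d))\<close> with an
  absolute constant, which is good enough for \<open>n \<ge> 10\<close>; for the finitely many functions with
  \<open>n < 10\<close> the smallest equality protocols have bounded size.
\<close>

section \<open>Relations given by an equality\<close>

text \<open>Values in \<open>nat\<close> instead of \<open>real\<close> let
  \<open>prod_encode\<close> turn a pair of values into one value, which yields closure under
  conjunction. They are embedded into the reals only when the protocol is built.\<close>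

definition equality_rel :: "nat \<Rightarrow> (bool list \<Rightarrow> bool list \<Rightarrow> bool) \<Rightarrow> bool" where
  "equality_rel n R \<longleftrightarrow>
     (\<exists>q r :: bool list \<Rightarrow> nat. \<forall>x\<in>cube n. \<forall>y\<in>cube n. R x y \<longleftrightarrow> q x = r y)"

lemma equality_relI:
  fixes q r :: "bool list \<Rightarrow> nat"
  assumes "\<And>x y. x \<in> cube n \<Longrightarrow> y \<in> cube n \<Longrightarrow> R x y \<longleftrightarrow> q x = r y"
  shows "equality_rel n R"
  unfolding equality_rel_def using assms by blast

lemma equality_rel_const: "equality_rel n (\<lambda>x y. b)"
  by (rule equality_relI[where q = "\<lambda>x. 0" and r = "\<lambda>y. if b then 0 else 1"]) auto

lemma equality_rel_left: "equality_rel n (\<lambda>x y. p x)"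
  by (rule equality_relI[where q = "\<lambda>x. if p x then 0 else 1" and r = "\<lambda>y. 0"]) auto

lemma equality_rel_right: "equality_rel n (\<lambda>x y. p y)"
  by (rule equality_relI[where q = "\<lambda>x. 0" and r = "\<lambda>y. if p y then 0 else 1"]) auto

lemma equality_rel_conj:
  assumes "equality_rel n R" "equality_rel n S"
  shows "equality_rel n (\<lambda>x y. R x y \<and> S x y)"
proof -
  obtain q r q' r' :: "bool list \<Rightarrow> nat"
    where "\<forall>x\<in>cube n. \<forall>y\<in>cube n. R x y \<longleftrightarrow> q x = r y"
      and "\<forall>x\<in>cube n. \<forall>y\<in>cube n. S x y \<longleftrightarrow> q' x = r' y"
    using assms unfolding equality_rel_def by blast
  then show ?thesis
    by (intro equality_relI[where q = "\<lambda>x. prod_encode (q x, q' x)"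
          and r = "\<lambda>y. prod_encode (r y, r' y)"]) auto
qed

lemma equality_rel_Ball:
  assumes "finite J" "\<And>j. j \<in> J \<Longrightarrow> equality_rel n (R j)"
  shows "equality_rel n (\<lambda>x y. \<forall>j\<in>J. R j x y)"
  using assms by (induction J) (auto simp: equality_rel_const intro: equality_rel_conj)

section \<open>From a graph of equality relations to a protocol\<close>

text \<open>Only the nodes reachable from \<open>v0\<close> are kept, which makes \<open>v0\<close>
  the unique source: every other reachable node has a reachable predecessor. Successors of reachable
  nodes are reachable, so the conditions on sinks and on steps survive the restriction.\<close>

lemma equality_protocol_of_dag:
  fixes succs :: "'a \<Rightarrow> 'a set"
  assumes fin: "finite N" and v0: "v0 \<in> N"
    and closed: "\<And>v u. v \<in> N \<Longrightarrow> u \<in> succs v \<Longrightarrow> u \<in> N"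
    and deg: "\<And>v. v \<in> N \<Longrightarrow> card (succs v) \<le> d"
    and wf: "wf {(u, v). v \<in> N \<and> u \<in> succs v}"
    and eq: "\<And>v. v \<in> N \<Longrightarrow> equality_rel n (R v)"
    and sink: "\<And>v. v \<in> N \<Longrightarrow> succs v = {} \<Longrightarrow>
       \<exists>i<n. \<forall>x\<in>cube n. \<forall>y\<in>cube n. R v x y \<longleftrightarrow> \<not> x ! i \<and> y ! i"
    and dom: "zeros f \<subseteq> cube n" "ones f \<subseteq> cube n"
    and start: "\<And>x y. x \<in> zeros f \<Longrightarrow> y \<in> ones f \<Longrightarrow> R v0 x y"
    and step: "\<And>v x y. v \<in> N \<Longrightarrow> succs v \<noteq> {} \<Longrightarrow> x \<in> zeros f \<Longrightarrow> y \<in> ones f \<Longrightarrow>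
       R v x y \<Longrightarrow> \<exists>u\<in>succs v. R u x y"
  shows "\<exists>Q :: nat protocol. equality_protocol n d Q \<and> solves Q f \<and> protocol_size Q \<le> card N"
proof -
  define E where "E = {(v, u). v \<in> N \<and> u \<in> succs v}"
  define V where "V = E\<^sup>* `` {v0}"
  have VN: "V \<subseteq> N"
  proof
    fix v assume "v \<in> V"
    then have "(v0, v) \<in> E\<^sup>*" by (simp add: V_def)
    then show "v \<in> N" by (induction) (auto simp: v0 E_def closed)
  qed
  have v0_V: "v0 \<in> V" by (simp add: V_def)
  have V_closed: "u \<in> V" if "v \<in> V" "u \<in> succs v" for u v
  proof -
    have "(v, u) \<in> E" using that VN by (auto simp: E_def)
    then show ?thesis using that unfolding V_def by (auto intro: rtrancl_into_rtrancl)
  qed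
  obtain g :: "'a \<Rightarrow> nat" where g: "inj_on g N"
    using finite_imp_inj_to_nat_seg[OF fin] by blast
  have g_eq: "g u = g v \<longleftrightarrow> u = v" if "u \<in> V" "v \<in> V" for u v
    using g that VN by (auto dest: inj_onD)
  define Q where "Q = \<lparr>verts = g ` V, edges = {(g v, g u) | v u. v \<in> V \<and> u \<in> succs v},
     feasible = {(x, y, g v) | x y v. x \<in> cube n \<and> y \<in> cube n \<and> v \<in> V \<and> R v x y}\<rparr>"
  have verts: "verts Q = g ` V" by (simp add: Q_def)
  have children: "children Q (g v) = g ` succs v" if "v \<in> V" for v
    using that by (auto simp: children_def Q_def g_eq)
  have feasible: "(x, y, g v) \<in> feasible Q \<longleftrightarrow> R v x y"
    if "v \<in> V" "x \<in> cube n" "y \<in> cube n" for v x y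
    using that by (auto simp: Q_def g_eq)
  have acyclic: "acyclic (edges Q)"
  proof -
    have "(edges Q)\<inverse> \<subseteq> inv_image {(u, v). v \<in> N \<and> u \<in> succs v} (inv_into N g)"
    proof clarify
      fix a b assume "(a, b) \<in> edges Q"
      then obtain v u where "a = g v" "b = g u" "v \<in> V" "u \<in> succs v"
        by (auto simp: Q_def)
      then show "(b, a) \<in> inv_image {(u, v). v \<in> N \<and> u \<in> succs v} (inv_into N g)"
        using VN V_closed closed by (auto simp: in_inv_image inv_into_f_f[OF g] subset_iff)
    qed
    then have "wf ((edges Q)\<inverse>)" by (rule wf_subset[OF wf_inv_image[OF wf]])
    then have "acyclic ((edges Q)\<inverse>)" by (rule wf_acyclic)
    then show ?thesis by (simp only: acyclic_converse)
  qed
  have source: "is_source Q z \<longleftrightarrow> z = g v0" for z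
  proof
    assume z: "is_source Q z"
    then obtain v where v: "v \<in> V" "z = g v" by (auto simp: is_source_def verts)
    have "(v0, v) \<in> E\<^sup>*" using v by (simp add: V_def)
    then show "z = g v0"
    proof (cases rule: rtranclE)
      case (step u)
      then have "u \<in> V" "v \<in> succs u" by (auto simp: V_def E_def)
      then have "(g u, z) \<in> edges Q" using v by (auto simp: Q_def)
      then show ?thesis using z by (auto simp: is_source_def)
    qed (simp add: v)
  next
    assume z: "z = g v0"
    \<comment> \<open>An edge into \<open>v0\<close> would start at a node reachable from
      \<open>v0\<close> and so close a cycle.\<close>
    have "(a, g v0) \<notin> edges Q" for a
    proof
      assume "(a, g v0) \<in> edges Q"
      then obtain v u where vu: "v \<in> V" "u \<in> succs v" "g u = g v0" by (auto simp: Q_def)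
      then have "u = v0" using g_eq[of u v0] v0_V V_closed[OF vu(1,2)] by simp
      then have "v0 \<in> succs v" using vu by simp
      then have "(v, v0) \<in> E" using vu VN by (auto simp: E_def)
      moreover have "(v0, v) \<in> E\<^sup>*" using vu by (simp add: V_def)
      ultimately have "(v0, v0) \<in> E\<^sup>+" by auto
      moreover have "acyclic E"
      proof -
        have "E\<inverse> = {(u, v). v \<in> N \<and> u \<in> succs v}" by (auto simp: E_def)
        then have "acyclic (E\<inverse>)" using wf_acyclic[OF wf] by simp
        then show ?thesis by (simp only: acyclic_converse)
      qed
      ultimately show False by (simp add: acyclic_def)
    qed
    then show "is_source Q z" using z v0_V by (auto simp: is_source_def verts)
  qed
  have finV: "finite V" using fin VN by (rule rev_finite_subset)
  have "is_protocol n d Q"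
    unfolding is_protocol_def
  proof (intro conjI ballI allI impI)
    show "finite (verts Q)" by (simp add: verts finV)
    show "edges Q \<subseteq> verts Q \<times> verts Q" using V_closed by (auto simp: Q_def)
    show "acyclic (edges Q)" by (rule acyclic)
    show "feasible Q \<subseteq> cube n \<times> cube n \<times> verts Q" by (auto simp: Q_def)
    show "\<exists>!v. is_source Q v" by (simp add: source)
    show "card (children Q v) \<le> d" if v: "v \<in> verts Q" for v
    proof -
      obtain w where w: "w \<in> V" "v = g w" using v by (auto simp: verts)
      have "succs w \<subseteq> N" using w VN closed by auto
      then have "card (g ` succs w) \<le> card (succs w)"
        by (intro card_image_le) (rule finite_subset[OF _ fin])
      then show ?thesis using deg[of w] w VN by (auto simp: children)
    qed
    show "\<exists>i<n. \<forall>x\<in>cube n. \<forall>y\<in>cube n. (x, y, l) \<in> feasible Q \<longleftrightarrow> \<not> x ! i \<and> y ! i"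
      if l: "is_sink Q l" for l
    proof -
      obtain w where w: "w \<in> V" "l = g w" using l by (auto simp: is_sink_def verts)
      then have "succs w = {}" using l by (auto simp: is_sink_def children)
      then show ?thesis using sink[of w] w VN by (auto simp: feasible)
    qed
  qed
  moreover have "\<exists>q r :: bool list \<Rightarrow> real. \<forall>x\<in>cube n. \<forall>y\<in>cube n.
        (x, y, v) \<in> feasible Q \<longleftrightarrow> q x = r y" if v: "v \<in> verts Q" for v
  proof -
    obtain w where w: "w \<in> V" "v = g w" using v by (auto simp: verts)
    obtain q r :: "bool list \<Rightarrow> nat" where "\<forall>x\<in>cube n. \<forall>y\<in>cube n. R w x y \<longleftrightarrow> q x = r y"
      using eq[of w] w VN unfolding equality_rel_def by auto
    then show ?thesis using w
      by (intro exI[of _ "\<lambda>x. real (q x)"] exI[of _ "\<lambda>y. real (r y)"]) (simp add: feasible)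
  qed
  ultimately have "equality_protocol n d Q" by (simp add: equality_protocol_def)
  moreover have "solves Q f"
    unfolding solves_def
  proof (intro ballI conjI allI impI)
    fix x y v assume xy: "x \<in> zeros f" "y \<in> ones f"
    then have c: "x \<in> cube n" "y \<in> cube n" using dom by auto
    show "(x, y, v) \<in> feasible Q" if "is_source Q v"
      using that start[OF xy] by (simp add: source feasible v0_V c)
    assume v: "v \<in> verts Q" "children Q v \<noteq> {}" "(x, y, v) \<in> feasible Q"
    then obtain w where w: "w \<in> V" "v = g w" by (auto simp: verts)
    then have "R w x y" "succs w \<noteq> {}" using v c by (auto simp: feasible children)
    then obtain u where "u \<in> succs w" "R u x y" using step[of w x y] w VN xy by auto
    then show "\<exists>u\<in>children Q v. (x, y, u) \<in> feasible Q"
      using w c V_closed by (auto simp: children feasible)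
  qed
  moreover have "protocol_size Q \<le> card N"
  proof -
    have "card (g ` V) \<le> card V" by (rule card_image_le[OF finV])
    also have "\<dots> \<le> card N" by (rule card_mono[OF fin VN])
    finally show ?thesis by (simp add: protocol_size_def verts)
  qed
  ultimately show ?thesis by blast
qed

section \<open>Ranks in place of real values\<close>

lemma card_cube: "finite (cube n)" "card (cube n) = 2 ^ n"
  using finite_lists_length_eq[of "UNIV :: bool set" n] card_lists_length_eq[of "UNIV :: bool set" n]
  by (auto simp: cube_def)

text \<open>
  A threshold \<open>r y\<close> is replaced by the number of points of \<open>X\<close> below it. Since \<open>card X\<close> itself can
  occur, \<open>X = cube n\<close> needs \<open>n + 1\<close> bits.
\<close>

lemma less_rel_as_nat:
  fixes q r :: "'a \<Rightarrow> real"
  assumes "finite X"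
  shows "\<exists>a b :: 'a \<Rightarrow> nat. (\<forall>x\<in>X. a x \<le> card X) \<and> (\<forall>y. b y \<le> card X) \<and>
    (\<forall>x\<in>X. \<forall>y. q x < r y \<longleftrightarrow> a x < b y)"
proof (intro exI conjI ballI allI)
  let ?a = "\<lambda>x. card {z \<in> X. q z < q x}" and ?b = "\<lambda>y. card {z \<in> X. q z < r y}"
  show "?a x \<le> card X" for x using assms by (intro card_mono) auto
  show "?b y \<le> card X" for y using assms by (intro card_mono) auto
  show "q x < r y \<longleftrightarrow> ?a x < ?b y" if "x \<in> X" for x y
  proof
    assume "q x < r y"
    \<comment> \<open>The point \<open>x\<close> itself makes the inclusion proper.\<close>
    then have "{z \<in> X. q z < q x} \<subset> {z \<in> X. q z < r y}" using that by auto
    then show "?a x < ?b y" using assms by (intro psubset_card_mono) auto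
  next
    assume less: "?a x < ?b y"
    show "q x < r y"
    proof (rule ccontr)
      assume "\<not> q x < r y"
      then have "?b y \<le> ?a x" using assms by (intro card_mono) auto
      then show False using less by simp
    qed
  qed
qed

section \<open>Comparing two numbers bit by bit\<close>

text \<open>
  \<open>Diff t\<close>, \<open>Less t\<close> and \<open>Greater t\<close> say that bit \<open>t\<close> is the leading bit in which two numbers
  differ; \<open>Eq t\<close> says that they agree in all bits from \<open>t\<close> upwards.
\<close>

datatype atom = Eq nat | Diff nat | Less nat | Greater nat

fun holds :: "atom \<Rightarrow> nat \<Rightarrow> nat \<Rightarrow> bool" where
  "holds (Eq t) a b \<longleftrightarrow> a div 2 ^ t = b div 2 ^ t"
| "holds (Diff t) a b \<longleftrightarrow> a div 2 ^ Suc t = b div 2 ^ Suc t \<and> a div 2 ^ t \<noteq> b div 2 ^ t"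
| "holds (Less t) a b \<longleftrightarrow> a div 2 ^ Suc t = b div 2 ^ Suc t \<and> a div 2 ^ t < b div 2 ^ t"
| "holds (Greater t) a b \<longleftrightarrow> a div 2 ^ Suc t = b div 2 ^ Suc t \<and> b div 2 ^ t < a div 2 ^ t"

fun final :: "atom \<Rightarrow> bool" where
  "final (Eq t) \<longleftrightarrow> t = 0"
| "final (Diff t) \<longleftrightarrow> False"
| "final (Less t) \<longleftrightarrow> True"
| "final (Greater t) \<longleftrightarrow> True"

lemma holds_Less_imp_less: "holds (Less t) a b \<Longrightarrow> a < b"
  using div_le_mono[of b a "2 ^ t"] by (auto simp: not_le[symmetric])

text \<open>Given \<open>a < b\<close>, both \<open>Eq 0\<close>, which means \<open>a = b\<close>,
  and every \<open>Greater t\<close> fail. A finished comparison of such a pair thus reveals the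
  position of the leading difference.\<close>

lemma final_holds_less:
  assumes "final A" "holds A a b" "a < b"
  shows "\<exists>t. A = Less t"
proof (cases A)
  case (Greater t)
  then show ?thesis using assms div_le_mono[of a b "2 ^ t"] by simp
qed (use assms in auto)

text \<open>The order conditions entangle \<open>a\<close> and \<open>b\<close>. Once the quotients
  by \<open>2 ^ Suc t\<close> agree, only bit \<open>t\<close> can distinguish the quotients by
  \<open>2 ^ t\<close>; this turns each condition into equalities between a function of
  \<open>a\<close> and a function of \<open>b\<close>, and conditions on one number alone, the forms
  covered by \<open>equality_rel\<close>.\<close>

lemma holds_iff_mod:
  "holds (Diff t) a b \<longleftrightarrow>
     a div 2 ^ Suc t = b div 2 ^ Suc t \<and> (a div 2 ^ t) mod 2 = 1 - (b div 2 ^ t) mod 2"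
  "holds (Less t) a b \<longleftrightarrow>
     a div 2 ^ Suc t = b div 2 ^ Suc t \<and> (a div 2 ^ t) mod 2 = 0 \<and> (b div 2 ^ t) mod 2 = 1"
  "holds (Greater t) a b \<longleftrightarrow>
     a div 2 ^ Suc t = b div 2 ^ Suc t \<and> (b div 2 ^ t) mod 2 = 0 \<and> (a div 2 ^ t) mod 2 = 1"
proof -
  have div_Suc: "z div 2 ^ Suc t = z div 2 ^ t div 2" for z :: nat
    by (simp only: power_Suc2 div_mult2_eq)
  have diff: "u div 2 = v div 2 \<and> u \<noteq> v \<longleftrightarrow> u div 2 = v div 2 \<and> u mod 2 = 1 - v mod 2"
    for u v :: nat
  proof -
    have "u = v \<longleftrightarrow> u mod 2 = v mod 2" if "u div 2 = v div 2"
      using that div_mult_mod_eq[of u 2] div_mult_mod_eq[of v 2] by auto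
    then show ?thesis by (auto simp: mod_2_eq_odd)
  qed
  have less: "u div 2 = v div 2 \<and> u < v \<longleftrightarrow> u div 2 = v div 2 \<and> u mod 2 = 0 \<and> v mod 2 = 1"
    for u v :: nat
    using div_mult_mod_eq[of u 2] div_mult_mod_eq[of v 2] mod_less_divisor[of 2 u]
      mod_less_divisor[of 2 v] by linarith
  show "holds (Diff t) a b \<longleftrightarrow>
     a div 2 ^ Suc t = b div 2 ^ Suc t \<and> (a div 2 ^ t) mod 2 = 1 - (b div 2 ^ t) mod 2"
    unfolding holds.simps div_Suc by (rule diff)
  show "holds (Less t) a b \<longleftrightarrow>
     a div 2 ^ Suc t = b div 2 ^ Suc t \<and> (a div 2 ^ t) mod 2 = 0 \<and> (b div 2 ^ t) mod 2 = 1"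
    unfolding holds.simps div_Suc by (rule less)
  show "holds (Greater t) a b \<longleftrightarrow>
     a div 2 ^ Suc t = b div 2 ^ Suc t \<and> (b div 2 ^ t) mod 2 = 0 \<and> (a div 2 ^ t) mod 2 = 1"
    unfolding holds.simps div_Suc using less[of "b div 2 ^ t" "a div 2 ^ t"] by metis
qed

lemma equality_rel_eq: "equality_rel n (\<lambda>x y. p x = p' y)"
  for p p' :: "bool list \<Rightarrow> nat"
  by (rule equality_relI) simp

lemma equality_rel_holds: "equality_rel n (\<lambda>x y. holds A (p x) (p' y))"
proof (cases A)
  case (Eq t)
  then show ?thesis by (simp add: equality_rel_eq)
next
  case (Diff t)
  show ?thesis unfolding Diff holds_iff_mod
    by (rule equality_rel_conj[OF equality_rel_eq equality_rel_eq])
next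
  case (Less t)
  show ?thesis unfolding Less holds_iff_mod
    by (rule equality_rel_conj[OF equality_rel_eq
          equality_rel_conj[OF equality_rel_left equality_rel_right]])
next
  case (Greater t)
  show ?thesis unfolding Greater holds_iff_mod
    by (rule equality_rel_conj[OF equality_rel_eq
          equality_rel_conj[OF equality_rel_right equality_rel_left]])
qed

text \<open>The index \<open>B\<close> is allowed only in \<open>Eq B\<close>, the state before any
  bit has been compared; the other atoms name one of the bit positions \<open>0\<close> to
  \<open>B - 1\<close>.\<close>

definition atoms :: "nat \<Rightarrow> atom set" where
  "atoms B = Eq ` {..B} \<union> Diff ` {..<B} \<union> Less ` {..<B} \<union> Greater ` {..<B}"

lemma atoms_iff [simp]:
  "Eq t \<in> atoms B \<longleftrightarrow> t \<le> B" "Diff t \<in> atoms B \<longleftrightarrow> t < B"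
  "Less t \<in> atoms B \<longleftrightarrow> t < B" "Greater t \<in> atoms B \<longleftrightarrow> t < B"
  by (auto simp: atoms_def)

lemma finite_atoms: "finite (atoms B)"
  by (simp add: atoms_def)

lemma card_atoms_le: "card (atoms B) \<le> 4 * B + 1"
proof -
  have "card (Eq ` {..B}) \<le> B + 1" "card (Diff ` {..<B}) \<le> B"
    "card (Less ` {..<B}) \<le> B" "card (Greater ` {..<B}) \<le> B"
    using card_image_le[of "{..B}" Eq] card_image_le[of "{..<B}"] by (auto simp: card_lessThan)
  then show ?thesis unfolding atoms_def
    using card_Un_le[of "Eq ` {..B} \<union> Diff ` {..<B} \<union> Less ` {..<B}" "Greater ` {..<B}"]
      card_Un_le[of "Eq ` {..B} \<union> Diff ` {..<B}" "Less ` {..<B}"]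
      card_Un_le[of "Eq ` {..B}" "Diff ` {..<B}"]
    by linarith
qed

section \<open>Nodes and their equality relations\<close>

text \<open>
  \<open>Node (Some v) K w\<close> represents vertex \<open>v\<close> together with the positions \<open>K\<close> of the leading
  differing bits of its \<open>c\<close> inequalities and the outcomes \<open>w\<close>, latest first, of the comparisons made
  so far for its children. \<open>Node None\<close> stands for a virtual parent of the source.
\<close>

datatype 'v node = Sink nat | Node "'v option" "nat list" "atom list"

text \<open>The bit length \<open>B\<close> is kept abstract; it becomes \<open>Suc n\<close> once
  the thresholds are ranks in the cube.\<close>

locale nat_conj_protocol =
  fixes n d c B :: nat and f :: partial_boolfun and P :: "'v protocol"
    and lo hi :: "'v \<Rightarrow> nat \<Rightarrow> bool list \<Rightarrow> nat"
  assumes n_pos: "n \<ge> 1" and d_pos: "d \<ge> 1"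
    and zeros_cube: "zeros f \<subseteq> cube n" and ones_cube: "ones f \<subseteq> cube n"
    and protocol: "is_protocol n d P" and solves: "solves P f"
    and lo_bound: "\<And>v j x. v \<in> verts P \<Longrightarrow> x \<in> cube n \<Longrightarrow> lo v j x < 2 ^ B"
    and hi_bound: "\<And>v j y. v \<in> verts P \<Longrightarrow> y \<in> cube n \<Longrightarrow> hi v j y < 2 ^ B"
    and feasible_iff: "\<And>v x y. v \<in> verts P \<Longrightarrow> x \<in> cube n \<Longrightarrow> y \<in> cube n \<Longrightarrow>
        (x, y, v) \<in> feasible P \<longleftrightarrow> (\<forall>j\<in>{1..c}. lo v j x < hi v j y)"
begin

definition source :: 'v where
  "source = (THE v. is_source P v)"

lemma is_source_source: "is_source P source"
  unfolding source_def by (rule theI') (use protocol in \<open>simp add: is_protocol_def\<close>)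

fun targets :: "'v option \<Rightarrow> 'v set" where
  "targets None = {source}"
| "targets (Some v) = children P v"

lemma finite_verts: "finite (verts P)"
  using protocol by (simp add: is_protocol_def)

abbreviation origins :: "'v option set" where
  "origins \<equiv> insert None (Some ` verts P)"

lemma targets_subset: "targets v \<subseteq> verts P"
  using protocol is_source_source
  by (cases v) (auto simp: is_protocol_def is_source_def children_def)

text \<open>The virtual parent \<open>None\<close> has one target, whence the appeal to
  \<open>d_pos\<close>.\<close>

lemma card_targets_le: "v \<in> origins \<Longrightarrow> card (targets v) \<le> d"
  using protocol d_pos by (auto simp: is_protocol_def)

text \<open>This fixes the order in which the inequalities of all targets are examined; any order
  would do.\<close>

definition comps :: "'v option \<Rightarrow> ('v \<times> nat) list" where
  "comps v = (SOME l. set l = targets v \<times> {1..c} \<and> distinct l)"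

lemma comps: "set (comps v) = targets v \<times> {1..c}" "distinct (comps v)"
proof -
  have "finite (targets v \<times> {1..c})"
    using finite_subset[OF targets_subset finite_verts] by simp
  then have "\<exists>l. set l = targets v \<times> {1..c} \<and> distinct l"
    using finite_distinct_list by blast
  then have "set (comps v) = targets v \<times> {1..c} \<and> distinct (comps v)"
    unfolding comps_def by (rule someI_ex)
  then show "set (comps v) = targets v \<times> {1..c}" "distinct (comps v)" by auto
qed

lemma length_comps_le:
  assumes "v \<in> origins"
  shows "length (comps v) \<le> c * d"
proof -
  have "length (comps v) = card (targets v) * c"
    using distinct_card[OF comps(2), of v] by (simp add: comps(1) card_cartesian_product)
  then show ?thesis using card_targets_le[OF assms] by (simp add: mult.commute)
qed

definition compare :: "atom \<Rightarrow> 'v \<times> nat \<Rightarrow> bool list \<Rightarrow> bool list \<Rightarrow> bool" where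
  "compare A p x y = holds A (lo (fst p) (snd p) x) (hi (fst p) (snd p) y)"

text \<open>Outcomes are stored latest first, so the head of \<open>A # w\<close> belongs to
  comparison number \<open>length w\<close>.\<close>

fun sat :: "('v \<times> nat) list \<Rightarrow> atom list \<Rightarrow> bool list \<Rightarrow> bool list \<Rightarrow> bool" where
  "sat cs [] x y = True"
| "sat cs (A # w) x y = (compare A (cs ! length w) x y \<and> sat cs w x y)"

text \<open>The atom \<open>A\<close> is chosen before \<open>x\<close> and \<open>y\<close>: the
  word alone fixes the outcome for all pairs at once. \<open>exit_candidate\<close> rests on this
  uniformity.\<close>

lemma sat_nth:
  assumes "i < length w"
  shows "\<exists>A\<in>set w. \<forall>x y. sat cs w x y \<longrightarrow> compare A (cs ! i) x y"
  using assms
proof (induction w)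
  case (Cons A w)
  show ?case
  proof (cases "i = length w")
    case False
    then obtain A' where "A' \<in> set w" "\<forall>x y. sat cs w x y \<longrightarrow> compare A' (cs ! i) x y"
      using Cons by auto
    then show ?thesis by (intro bexI[of _ A']) auto
  qed simp
qed simp

text \<open>An equality condition that strengthens feasibility of \<open>u\<close> by prescribing
  where the leading differences lie. Inequalities are numbered from 1 and list entries from 0, hence
  \<open>j - 1\<close>.\<close>

definition entry :: "'v \<Rightarrow> nat list \<Rightarrow> bool list \<Rightarrow> bool list \<Rightarrow> bool" where
  "entry u K x y = (\<forall>j\<in>{1..c}. compare (Less (K ! (j - 1))) (u, j) x y)"

fun rel :: "'v node \<Rightarrow> bool list \<Rightarrow> bool list \<Rightarrow> bool" where
  "rel (Sink i) x y = (\<not> x ! i \<and> y ! i)"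
| "rel (Node v K w) x y =
     ((case v of None \<Rightarrow> True | Some u \<Rightarrow> entry u K x y) \<and> sat (comps v) w x y)"

lemma equality_rel_rel: "equality_rel n (rel z)"
proof (cases z)
  case (Sink i)
  then have "rel z = (\<lambda>x y. \<not> x ! i \<and> y ! i)" by (intro ext) simp
  then show ?thesis by (simp only:) (intro equality_rel_conj equality_rel_left equality_rel_right)
next
  case (Node v K w)
  have sat: "equality_rel n (sat cs w)" for cs w
  proof (induction w)
    case Nil
    have "sat cs [] = (\<lambda>x y. True)" by (intro ext) simp
    then show ?case by (simp add: equality_rel_const)
  next
    case (Cons A w)
    have "sat cs (A # w) = (\<lambda>x y. compare A (cs ! length w) x y \<and> sat cs w x y)"
      by (intro ext) simp
    then show ?case unfolding compare_def
      by (simp only:) (intro equality_rel_conj equality_rel_holds Cons)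
  qed
  have entry: "equality_rel n (entry u K)" for u
  proof -
    have "entry u K = (\<lambda>x y. \<forall>j\<in>{1..c}. compare (Less (K ! (j - 1))) (u, j) x y)"
      by (intro ext) (simp add: entry_def)
    then show ?thesis unfolding compare_def
      by (simp only:) (intro equality_rel_Ball equality_rel_holds finite_atLeastAtMost)
  qed
  show ?thesis
  proof (cases v)
    case None
    then have "rel z = sat (comps v) w" by (intro ext) (simp add: Node)
    then show ?thesis by (simp add: sat)
  next
    case (Some u)
    then have "rel z = (\<lambda>x y. entry u K x y \<and> sat (comps v) w x y)"
      by (intro ext) (simp add: Node)
    then show ?thesis by (simp only:) (intro equality_rel_conj entry sat)
  qed
qed

section \<open>The graph of comparisons\<close>

definition positions :: "nat list set" where
  "positions = {K. set K \<subseteq> {..<B} \<and> length K = c}"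

text \<open>Comparisons are made one after the other, so only the latest outcome, the head of the
  word, may be unfinished.\<close>

definition words :: "'v option \<Rightarrow> atom list set" where
  "words v = {w. set w \<subseteq> atoms B \<and> length w \<le> length (comps v) \<and> (\<forall>A\<in>set (tl w). final A)}"

definition nodes :: "'v node set" where
  "nodes = Sink ` {..<n} \<union> {Node v K w | v K w. v \<in> origins \<and> K \<in> positions \<and> w \<in> words v}"

definition exits :: "'v option \<Rightarrow> 'v node set" where
  "exits v = Sink ` {..<n} \<union> {Node (Some u) K [] | u K. u \<in> targets v \<and> K \<in> positions}"

text \<open>
  If no pair of inputs satisfies \<open>rel (Node v K w)\<close>, any sink qualifies, so the choice is never empty
  once all comparisons are finished.
\<close>

definition exit :: "'v option \<Rightarrow> nat list \<Rightarrow> atom list \<Rightarrow> 'v node" where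
  "exit v K w = (SOME z. z \<in> exits v \<and>
     (\<forall>x\<in>zeros f. \<forall>y\<in>ones f. rel (Node v K w) x y \<longrightarrow> rel z x y))"

lemma entry_imp_feasible:
  assumes "v \<in> verts P" "x \<in> cube n" "y \<in> cube n" "entry v K x y"
  shows "(x, y, v) \<in> feasible P"
proof -
  have "lo v j x < hi v j y" if "j \<in> {1..c}" for j
    using assms(4) that unfolding entry_def compare_def fst_conv snd_conv
    by (blast intro: holds_Less_imp_less)
  then show ?thesis using assms feasible_iff by blast
qed

lemma target_feasible:
  assumes "v \<in> origins" "targets v \<noteq> {}" "x \<in> zeros f" "y \<in> ones f" "rel (Node v K w) x y"
  shows "\<exists>u\<in>targets v. (x, y, u) \<in> feasible P"
proof (cases v)
  case None
  then show ?thesis using solves is_source_source assms by (auto simp: solves_def)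
next
  case (Some u)
  then have "(x, y, u) \<in> feasible P"
    using assms zeros_cube ones_cube by (intro entry_imp_feasible) auto
  moreover have "u \<in> verts P" "children P u \<noteq> {}" using Some assms by auto
  ultimately have "\<exists>w\<in>children P u. (x, y, w) \<in> feasible P"
    using assms(3,4) solves unfolding solves_def by blast
  then show ?thesis by (simp add: Some)
qed

text \<open>One pair decides for all. Take a target \<open>u\<close> feasible for a single pair
  satisfying the relation. At this pair every recorded outcome for \<open>u\<close> must be some
  \<open>Less t\<close>; the word is shared by all pairs in the relation, so they all satisfy the
  inequalities of \<open>u\<close> with the same leading positions. These positions form the list of
  the node to exit to.\<close>

lemma exit_candidate:
  assumes v: "v \<in> origins" and w: "set w \<subseteq> atoms B" "\<forall>A\<in>set w. final A"
    and len: "length w = length (comps v)"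
  shows "\<exists>z. z \<in> exits v \<and> (\<forall>x\<in>zeros f. \<forall>y\<in>ones f. rel (Node v K w) x y \<longrightarrow> rel z x y)"
proof (cases "\<exists>x\<in>zeros f. \<exists>y\<in>ones f. rel (Node v K w) x y")
  case False
  then show ?thesis using n_pos by (intro exI[of _ "Sink 0"]) (auto simp: exits_def)
next
  case True
  then obtain x0 y0 where xy0: "x0 \<in> zeros f" "y0 \<in> ones f" "rel (Node v K w) x0 y0" by blast
  show ?thesis
  proof (cases "targets v = {}")
    case True
    \<comment> \<open>\<open>None\<close> has the source as a target, so a node without targets
      belongs to a sink of \<open>P\<close>, and the index \<open>i\<close> of that sink yields
      \<open>Sink i\<close>.\<close>
    then obtain l where l: "v = Some l" "is_sink P l" using v by (auto simp: is_sink_def)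
    then obtain i where i: "i < n"
      "\<forall>x\<in>cube n. \<forall>y\<in>cube n. (x, y, l) \<in> feasible P \<longleftrightarrow> \<not> x ! i \<and> y ! i"
      using protocol unfolding is_protocol_def by blast
    have "rel (Sink i) x y" if "x \<in> zeros f" "y \<in> ones f" "rel (Node v K w) x y" for x y
    proof -
      have "x \<in> cube n" "y \<in> cube n" using that zeros_cube ones_cube by auto
      moreover from this have "(x, y, l) \<in> feasible P"
        using that l by (intro entry_imp_feasible) (auto simp: is_sink_def)
      ultimately show ?thesis using i by simp
    qed
    then show ?thesis using i(1) by (intro exI[of _ "Sink i"]) (auto simp: exits_def)
  next
    case False
    then obtain u where u: "u \<in> targets v" "(x0, y0, u) \<in> feasible P"
      using target_feasible[OF v _ xy0] by blast
    have "\<exists>t<B. \<forall>x y. sat (comps v) w x y \<longrightarrow> compare (Less t) (u, j) x y"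
      if j: "j \<in> {1..c}" for j
    proof -
      have "(u, j) \<in> set (comps v)" using u j by (simp add: comps)
      then obtain i where i: "i < length w" "comps v ! i = (u, j)"
        using len by (metis in_set_conv_nth)
      then obtain A where A: "A \<in> set w" "\<forall>x y. sat (comps v) w x y \<longrightarrow> compare A (u, j) x y"
        using sat_nth[OF i(1), of "comps v"] by auto
      have "lo u j x0 < hi u j y0"
        using u j xy0 targets_subset zeros_cube ones_cube feasible_iff by blast
      moreover have "holds A (lo u j x0) (hi u j y0)"
        using A xy0(3) by (auto simp: compare_def)
      ultimately obtain t where "A = Less t"
        using final_holds_less w(2) A(1) by blast
      moreover from this have "t < B" using A(1) w(1) by auto
      ultimately show ?thesis using A(2) by blast
    qed
    then obtain t where t: "\<And>j. j \<in> {1..c} \<Longrightarrow> t j < B"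
      "\<And>j x y. j \<in> {1..c} \<Longrightarrow> sat (comps v) w x y \<Longrightarrow> compare (Less (t j)) (u, j) x y"
      by metis
    define L where "L = map (\<lambda>j. t (Suc j)) [0..<c]"
    have nth_L: "L ! (j - 1) = t j" if "j \<in> {1..c}" for j
      using that by (auto simp: L_def)
    have "L \<in> positions" using t(1) by (auto simp: L_def positions_def)
    then have "Node (Some u) L [] \<in> exits v" using u by (auto simp: exits_def)
    moreover have "rel (Node (Some u) L []) x y" if R: "rel (Node v K w) x y" for x y
    proof -
      have "compare (Less (L ! (j - 1))) (u, j) x y" if "j \<in> {1..c}" for j
        unfolding nth_L[OF that] using that R by (intro t(2)) auto
      then show ?thesis by (simp add: entry_def)
    qed
    ultimately show ?thesis by blast
  qed
qed

lemma exit_correct: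
  assumes "v \<in> origins" "set w \<subseteq> atoms B" "\<forall>A\<in>set w. final A" "length w = length (comps v)"
  shows "exit v K w \<in> exits v"
    and "\<And>x y. x \<in> zeros f \<Longrightarrow> y \<in> ones f \<Longrightarrow> rel (Node v K w) x y \<Longrightarrow> rel (exit v K w) x y"
  using someI_ex[OF exit_candidate[OF assms, of K]] unfolding exit_def by auto

text \<open>A new comparison opens with \<open>Eq B\<close>, which holds for free: both numbers are
  below \<open>2 ^ B\<close>, so both quotients are 0.\<close>

definition proceed :: "'v option \<Rightarrow> nat list \<Rightarrow> atom list \<Rightarrow> 'v node" where
  "proceed v K w = (if length w < length (comps v) then Node v K (Eq B # w) else exit v K w)"

text \<open>The equations apply in order. The last one is left with the empty word and the heads
  \<open>Eq 0\<close>, \<open>Less t\<close> and \<open>Greater t\<close>, that is, with no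
  comparison in progress.\<close>

fun succs :: "'v node \<Rightarrow> 'v node set" where
  "succs (Sink i) = {}"
| "succs (Node v K (Eq (Suc t) # w)) = {Node v K (Eq t # w), Node v K (Diff t # w)}"
| "succs (Node v K (Diff t # w)) = {Node v K (Less t # w), Node v K (Greater t # w)}"
| "succs (Node v K w) = {proceed v K w}"

lemma node_cases [consumes 1, case_names sink eq diff proceed]:
  assumes "z \<in> nodes"
  obtains (sink) i where "z = Sink i" "i < n"
  | (eq) v K t w where "z = Node v K (Eq (Suc t) # w)" "v \<in> origins" "K \<in> positions"
      "Eq (Suc t) # w \<in> words v"
  | (diff) v K t w where "z = Node v K (Diff t # w)" "v \<in> origins" "K \<in> positions"
      "Diff t # w \<in> words v"
  | (proceed) v K w where "z = Node v K w" "v \<in> origins" "K \<in> positions" "w \<in> words v"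
      "\<forall>A\<in>set w. final A" "succs z = {proceed v K w}"
proof (cases z)
  case (Sink i)
  then show ?thesis using assms sink by (auto simp: nodes_def)
next
  case (Node v K w)
  then have N: "v \<in> origins" "K \<in> positions" "w \<in> words v" using assms by (auto simp: nodes_def)
  show ?thesis
  proof (cases w)
    case Nil
    then show ?thesis using N Node by (intro proceed) auto
  next
    case (Cons A w')
    show ?thesis
    proof (cases A)
      case (Eq t)
      show ?thesis
      proof (cases t)
        case 0
        then show ?thesis using N Node Cons Eq by (intro proceed) (auto simp: words_def)
      next
        case (Suc t')
        then show ?thesis using N Node Cons Eq by (intro eq) auto
      qed
    next
      case (Diff t)
      then show ?thesis using N Node Cons by (intro diff) auto
    qed (use N Node Cons in \<open>auto intro!: proceed simp: words_def\<close>)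
  qed
qed

lemma proceed_cases [consumes 3, case_names compare exit]:
  assumes "v \<in> origins" "w \<in> words v" "\<forall>A\<in>set w. final A"
  obtains (compare) "length w < length (comps v)" "proceed v K w = Node v K (Eq B # w)"
    "Eq B # w \<in> words v"
  | (exit) "length w = length (comps v)" "proceed v K w = exit v K w" "exit v K w \<in> exits v"
proof (cases "length w < length (comps v)")
  case True
  then show ?thesis using assms compare by (auto simp: proceed_def words_def)
next
  case False
  then have "length w = length (comps v)" using assms by (auto simp: words_def)
  then show ?thesis using assms exit exit_correct(1) by (auto simp: proceed_def words_def)
qed

lemma exits_subset: "exits v \<subseteq> nodes"
  using targets_subset[of v] unfolding exits_def nodes_def by (force simp: words_def)

lemma succs_closed:
  assumes "z \<in> nodes" "z' \<in> succs z"
  shows "z' \<in> nodes"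
  using assms(1)
proof (cases rule: node_cases)
  case (proceed v K w)
  from proceed(2,4,5) show ?thesis
  proof (cases rule: proceed_cases[where K = K])
    case compare
    then show ?thesis using proceed assms(2) by (auto simp: nodes_def)
  next
    case exit
    then show ?thesis using proceed assms(2) exits_subset by auto
  qed
qed (use assms(2) in \<open>auto simp: nodes_def words_def\<close>)

lemma card_succs_le: "card (succs z) \<le> 2"
  by (cases z rule: succs.cases) (simp_all add: card_insert_if)

text \<open>Below an agreeing prefix, the next bit either agrees too or is the leading difference,
  and a difference goes one way or the other. Starting a comparison is harmless, and leaving the
  node is covered by \<open>exit_correct\<close>.\<close>

lemma succs_sound:
  assumes "z \<in> nodes" "succs z \<noteq> {}" "x \<in> zeros f" "y \<in> ones f" "rel z x y"
  shows "\<exists>z'\<in>succs z. rel z' x y"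
  using assms(1)
proof (cases rule: node_cases)
  case (proceed v K w)
  have cube: "x \<in> cube n" "y \<in> cube n" using assms zeros_cube ones_cube by auto
  from proceed(2,4,5) have "rel (proceed v K w) x y"
  proof (cases rule: proceed_cases[where K = K])
    case compare
    then have "comps v ! length w \<in> targets v \<times> {1..c}" using comps nth_mem by blast
    then have "fst (comps v ! length w) \<in> verts P"
      using targets_subset[of v] by auto
    then have "compare (Eq B) (comps v ! length w) x y"
      using lo_bound hi_bound cube by (simp add: compare_def)
    then show ?thesis using assms(5) proceed(1) compare(2) by simp
  next
    case exit
    then show ?thesis using assms proceed exit_correct(2)[of v w] by (simp add: words_def)
  qed
  then show ?thesis using proceed by simp
qed (use assms in \<open>auto simp: compare_def\<close>)

section \<open>Termination\<close>

lemma descendants_less: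
  assumes "v \<in> verts P" "u \<in> children P v"
  shows "card ((edges P)\<^sup>+ `` {u}) < card ((edges P)\<^sup>+ `` {v})"
proof (rule psubset_card_mono)
  have sub: "edges P \<subseteq> verts P \<times> verts P" and acyc: "acyclic (edges P)"
    using protocol by (auto simp: is_protocol_def)
  have "(edges P)\<^sup>+ \<subseteq> verts P \<times> verts P" using trancl_subset_Sigma[OF sub] .
  then show "finite ((edges P)\<^sup>+ `` {v})" by (intro finite_subset[OF _ finite_verts]) auto
  have vu: "(v, u) \<in> edges P" using assms by (simp add: children_def)
  then have "(edges P)\<^sup>+ `` {u} \<subseteq> (edges P)\<^sup>+ `` {v}" by (auto intro: trancl_into_trancl2)
  moreover have "u \<in> (edges P)\<^sup>+ `` {v}" "u \<notin> (edges P)\<^sup>+ `` {u}"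
    using vu acyc by (auto simp: acyclic_def)
  ultimately show "(edges P)\<^sup>+ `` {u} \<subset> (edges P)\<^sup>+ `` {v}" by auto
qed

text \<open>Counting proper descendants in \<open>P\<close> ranks its vertices. The offsets place
  every \<open>Sink\<close> at the bottom and the virtual parent just above the source.\<close>

fun level :: "'v node \<Rightarrow> nat" where
  "level (Sink i) = 0"
| "level (Node (Some v) K w) = Suc (card ((edges P)\<^sup>+ `` {v}))"
| "level (Node None K w) = Suc (Suc (card ((edges P)\<^sup>+ `` {source})))"

fun remaining :: "'v node \<Rightarrow> nat" where
  "remaining (Sink i) = 0"
| "remaining (Node v K w) = length (comps v) - length w"

text \<open>The scan goes from \<open>Eq (Suc t)\<close> to \<open>Eq t\<close> or
  \<open>Diff t\<close>, and from \<open>Diff t\<close> to a final atom; the offset 2 keeps every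
  \<open>Eq\<close> above \<open>Diff\<close>.\<close>

fun phase :: "'v node \<Rightarrow> nat" where
  "phase (Node v K (Eq t # w)) = t + 2"
| "phase (Node v K (Diff t # w)) = 1"
| "phase _ = 0"

lemma level_exits_less:
  assumes "v \<in> origins" "z \<in> exits v"
  shows "level z < level (Node v K w)"
proof (cases v)
  case None
  then show ?thesis using assms by (auto simp: exits_def)
next
  case (Some u)
  then show ?thesis using assms descendants_less[of u] by (auto simp: exits_def)
qed

lemma level_Node_eq: "level (Node v K w) = level (Node v K' w')"
  by (cases v) auto

text \<open>Lexicographic descent: an exit lowers \<open>level\<close>, opening a comparison keeps
  it and lowers \<open>remaining\<close>, and a scanning step keeps both and lowers
  \<open>phase\<close>.\<close>

lemma wf_succs: "wf {(z', z). z \<in> nodes \<and> z' \<in> succs z}"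
proof (rule wf_subset[OF wf_measures])
  show "{(z', z). z \<in> nodes \<and> z' \<in> succs z} \<subseteq> measures [level, remaining, phase]"
  proof clarify
    fix z z' assume z: "z \<in> nodes" "z' \<in> succs z"
    from z(1) show "(z', z) \<in> measures [level, remaining, phase]"
    proof (cases rule: node_cases)
      case (eq v K t w)
      then show ?thesis
        using z(2) level_Node_eq[of v K "Eq t # w" K "Eq (Suc t) # w"]
          level_Node_eq[of v K "Diff t # w" K "Eq (Suc t) # w"] by auto
    next
      case (diff v K t w)
      then show ?thesis
        using z(2) level_Node_eq[of v K "Less t # w" K "Diff t # w"]
          level_Node_eq[of v K "Greater t # w" K "Diff t # w"] by auto
    next
      case (proceed v K w)
      from proceed(2,4,5) show ?thesis
      proof (cases rule: proceed_cases[where K = K])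
        case compare
        then show ?thesis
          using z(2) proceed level_Node_eq[of v K "Eq B # w" K w] by auto
      next
        case exit
        then show ?thesis
          using z(2) proceed level_exits_less[of v "exit v K w" K w] by auto
      qed
    qed (use z(2) in auto)
  qed
qed

section \<open>Counting the nodes\<close>

text \<open>Bounding the word length uniformly by \<open>c * d\<close> removes the dependence on
  \<open>v\<close> and leaves a product, whose cardinality is easy to compute.\<close>

lemma nodes_subset:
  "nodes \<subseteq> Sink ` {..<n} \<union> (\<lambda>(v, K, w). Node v K w) `
     (origins \<times> positions \<times> {w. set w \<subseteq> atoms B \<and> length w \<le> c * d})"
proof -
  have "length w \<le> c * d" if "v \<in> origins" "w \<in> words v" for v w
    using length_comps_le[OF that(1)] that(2) by (auto simp: words_def)
  then have "w \<in> {w. set w \<subseteq> atoms B \<and> length w \<le> c * d}"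
    if "v \<in> origins" "w \<in> words v" for v w
    using that unfolding words_def by blast
  then have "Node v K w \<in> (\<lambda>(v, K, w). Node v K w) `
     (origins \<times> positions \<times> {w. set w \<subseteq> atoms B \<and> length w \<le> c * d})"
    if "v \<in> origins" "K \<in> positions" "w \<in> words v" for v K w
    using that by (intro image_eqI[of _ _ "(v, K, w)"] SigmaI) auto
  then show ?thesis unfolding nodes_def by blast
qed

lemma card_nodes_le:
  "finite nodes"
  "card nodes \<le> n + (card (verts P) + 1) * (B ^ c * (\<Sum>i\<le>c * d. (4 * B + 1) ^ i))"
proof -
  let ?W = "{w. set w \<subseteq> atoms B \<and> length w \<le> c * d}"
  let ?T = "origins \<times> positions \<times> ?W"
  have fin: "finite positions" "finite ?W" "finite origins"
    using finite_verts
    by (auto simp: positions_def finite_lists_length_eq finite_lists_length_le finite_atoms)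
  then have finT: "finite ?T" by simp
  show "finite nodes" by (rule finite_subset[OF nodes_subset]) (use finT in auto)
  have "card nodes \<le> card (Sink ` {..<n} \<union> (\<lambda>(v, K, w). Node v K w) ` ?T)"
    by (rule card_mono[OF _ nodes_subset]) (use finT in auto)
  also have "\<dots> \<le> card (Sink ` {..<n} :: 'v node set) + card ((\<lambda>(v, K, w). Node v K w) ` ?T)"
    by (rule card_Un_le)
  also have "\<dots> \<le> card {..<n} + card ?T"
    by (intro add_mono card_image_le finT) auto
  also have "\<dots> = n + card origins * (card positions * card ?W)"
    by (simp only: card_cartesian_product card_lessThan)
  also have "\<dots> \<le> n + (card (verts P) + 1) * (B ^ c * (\<Sum>i\<le>c * d. (4 * B + 1) ^ i))"
  proof (intro add_left_mono mult_le_mono)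
    show "card origins \<le> card (verts P) + 1"
      using finite_verts by (simp add: card_image)
    show "card positions \<le> B ^ c"
      by (simp add: positions_def card_lists_length_eq)
    show "card ?W \<le> (\<Sum>i\<le>c * d. (4 * B + 1) ^ i)"
      unfolding card_lists_length_le[OF finite_atoms]
      by (intro sum_mono power_mono card_atoms_le) auto
  qed
  finally show "card nodes \<le> n + (card (verts P) + 1) * (B ^ c * (\<Sum>i\<le>c * d. (4 * B + 1) ^ i))" .
qed

lemma equality_protocol_exists:
  assumes "B \<ge> 1"
  shows "\<exists>Q :: nat protocol. equality_protocol n 2 Q \<and> solves Q f \<and>
    protocol_size Q \<le> n + (card (verts P) + 1) * (B ^ c * (\<Sum>i\<le>c * d. (4 * B + 1) ^ i))"
proof -
  \<comment> \<open>The zeros are placeholders that put the list into \<open>positions\<close>;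
    position 0 exists because \<open>B >= 1\<close>.\<close>
  let ?v0 = "Node None (replicate c 0) []"
  have "\<exists>Q :: nat protocol. equality_protocol n 2 Q \<and> solves Q f \<and> protocol_size Q \<le> card nodes"
  proof (rule equality_protocol_of_dag[where R = rel and succs = succs and ?v0.0 = ?v0])
    show "?v0 \<in> nodes" using assms by (auto simp: nodes_def positions_def words_def)
    show "\<exists>i<n. \<forall>x\<in>cube n. \<forall>y\<in>cube n. rel z x y \<longleftrightarrow> \<not> x ! i \<and> y ! i"
      if "z \<in> nodes" "succs z = {}" for z
      using that(1) by (cases rule: node_cases) (use that(2) in auto)
    show "rel ?v0 x y" for x y by simp
  qed (rule card_nodes_le(1) succs_closed card_succs_le wf_succs equality_rel_rel zeros_cube
      ones_cube succs_sound; assumption)+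
  then show ?thesis using card_nodes_le(2) le_trans by blast
qed

end

section \<open>Application to real inequalities and the size estimate\<close>

lemma conj_ineq_as_nat:
  assumes "conj_ineq_protocol n d c P"
  shows "\<exists>lo hi :: 'v \<Rightarrow> nat \<Rightarrow> bool list \<Rightarrow> nat. \<forall>v\<in>verts (P :: 'v protocol).
     (\<forall>j. \<forall>x\<in>cube n. lo v j x < 2 ^ Suc n) \<and> (\<forall>j. \<forall>y\<in>cube n. hi v j y < 2 ^ Suc n) \<and>
     (\<forall>x\<in>cube n. \<forall>y\<in>cube n. (x, y, v) \<in> feasible P \<longleftrightarrow> (\<forall>j\<in>{1..c}. lo v j x < hi v j y))"
proof -
  have "\<exists>a b :: nat \<Rightarrow> bool list \<Rightarrow> nat.
     (\<forall>j. \<forall>x\<in>cube n. a j x < 2 ^ Suc n) \<and> (\<forall>j. \<forall>y\<in>cube n. b j y < 2 ^ Suc n) \<and>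
     (\<forall>x\<in>cube n. \<forall>y\<in>cube n. (x, y, v) \<in> feasible P \<longleftrightarrow> (\<forall>j\<in>{1..c}. a j x < b j y))"
    if v: "v \<in> verts P" for v
  proof -
    obtain q r :: "nat \<Rightarrow> bool list \<Rightarrow> real" where qr: "\<forall>x\<in>cube n. \<forall>y\<in>cube n.
        (x, y, v) \<in> feasible P \<longleftrightarrow> (\<forall>j\<in>{1..c}. q j x < r j y)"
      using assms v unfolding conj_ineq_protocol_def by blast
    have "\<forall>j. \<exists>a b :: bool list \<Rightarrow> nat. (\<forall>x\<in>cube n. a x \<le> 2 ^ n) \<and> (\<forall>y. b y \<le> 2 ^ n) \<and>
        (\<forall>x\<in>cube n. \<forall>y. q j x < r j y \<longleftrightarrow> a x < b y)"
      using less_rel_as_nat[OF card_cube(1)[of n]] by (simp add: card_cube(2))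
    then obtain a b :: "nat \<Rightarrow> bool list \<Rightarrow> nat"
      where ab: "\<And>j x. x \<in> cube n \<Longrightarrow> a j x \<le> 2 ^ n" "\<And>j y. b j y \<le> 2 ^ n"
        "\<And>j x y. x \<in> cube n \<Longrightarrow> q j x < r j y \<longleftrightarrow> a j x < b j y"
      by metis
    have less: "(2 :: nat) ^ n < 2 ^ Suc n" by simp
    have "\<forall>j. \<forall>x\<in>cube n. a j x < 2 ^ Suc n" "\<forall>j. \<forall>y\<in>cube n. b j y < 2 ^ Suc n"
      using ab(1,2) le_less_trans[OF _ less] by blast+
    moreover have "\<forall>x\<in>cube n. \<forall>y\<in>cube n.
        (x, y, v) \<in> feasible P \<longleftrightarrow> (\<forall>j\<in>{1..c}. a j x < b j y)"
      using qr ab(3) by simp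
    ultimately show ?thesis by blast
  qed
  then show ?thesis by metis
qed

lemma equality_protocol_of_conj_ineq:
  fixes P :: "'v protocol"
  assumes "n \<ge> 1" "d \<ge> 1" "partial_monotone n f" "conj_ineq_protocol n d c P" "solves P f"
  shows "\<exists>Q :: nat protocol. equality_protocol n 2 Q \<and> solves Q f \<and> protocol_size Q \<le>
    n + (protocol_size P + 1) * (Suc n ^ c * (\<Sum>i\<le>c * d. (4 * Suc n + 1) ^ i))"
proof -
  obtain lo hi :: "'v \<Rightarrow> nat \<Rightarrow> bool list \<Rightarrow> nat" where lohi: "\<forall>v\<in>verts P.
     (\<forall>j. \<forall>x\<in>cube n. lo v j x < 2 ^ Suc n) \<and> (\<forall>j. \<forall>y\<in>cube n. hi v j y < 2 ^ Suc n) \<and>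
     (\<forall>x\<in>cube n. \<forall>y\<in>cube n. (x, y, v) \<in> feasible P \<longleftrightarrow> (\<forall>j\<in>{1..c}. lo v j x < hi v j y))"
    using conj_ineq_as_nat[OF assms(4)] by blast
  interpret nat_conj_protocol n d c "Suc n" f P lo hi
  proof
    show "zeros f \<subseteq> cube n" "ones f \<subseteq> cube n" using assms(3) by (auto simp: partial_monotone_def)
    show "is_protocol n d P" using assms(4) by (simp add: conj_ineq_protocol_def)
  qed (use assms lohi in blast)+
  show ?thesis using equality_protocol_exists by (simp add: protocol_size_def)
qed

lemma sum_powers_le:
  fixes a :: nat
  assumes "a \<ge> 2"
  shows "(\<Sum>i\<le>m. a ^ i) \<le> 2 * a ^ m"
proof (induction m)
  case (Suc m)
  have "(\<Sum>i\<le>Suc m. a ^ i) \<le> 2 * a ^ m + a ^ Suc m" using Suc by simp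
  also have "\<dots> \<le> a * a ^ m + a ^ Suc m" using assms by (intro add_right_mono mult_le_mono1)
  finally show ?case by simp
qed simp

text \<open>With \<open>m = c * d\<close>, the estimates \<open>Suc n <= 2 * n\<close> and
  \<open>4 * Suc n + 1 <= 5 * n\<close> produce the factor \<open>2 ^ m * 5 ^ m = 10 ^ m\<close>. It
  is at most \<open>10 * n ^ (m - 1)\<close> because \<open>n >= 10\<close>, and the exponents
  \<open>c\<close>, \<open>m\<close> and \<open>m - 1\<close> add up to the required one. The
  constant is \<open>41 = 1 + 2 * 20\<close>, from the summand \<open>n\<close> and from
  \<open>s + 1 <= 2 * s\<close>.\<close>

lemma size_bound:
  fixes n d c s :: nat
  assumes n: "n \<ge> 10" and "d \<ge> 1" "c \<ge> 1" and s: "s \<ge> 1"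
  shows "n + (s + 1) * (Suc n ^ c * (\<Sum>i\<le>c * d. (4 * Suc n + 1) ^ i))
    \<le> 41 * (s * n ^ (2 * c * d + c - 1))"
proof -
  define m where "m = c * d"
  have m: "m \<ge> 1" "c \<le> m" using assms by (auto simp: m_def Suc_le_eq)
  have expo: "2 * c * d + c - 1 = c + (m + (m - 1))" using m(1) unfolding mult.assoc m_def[symmetric] by linarith
  have "Suc n ^ c \<le> (2 * n) ^ c" using n by (intro power_mono) auto
  also have "\<dots> \<le> 2 ^ m * n ^ c"
    unfolding power_mult_distrib using m by (intro mult_le_mono1 power_increasing) auto
  finally have 1: "Suc n ^ c \<le> 2 ^ m * n ^ c" .
  have "(\<Sum>i\<le>m. (4 * Suc n + 1) ^ i) \<le> 2 * (4 * Suc n + 1) ^ m"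
    by (rule sum_powers_le) simp
  also have "\<dots> \<le> 2 * (5 * n) ^ m" using n by (intro mult_le_mono2 power_mono) auto
  finally have 2: "(\<Sum>i\<le>m. (4 * Suc n + 1) ^ i) \<le> 2 * (5 * n) ^ m" .
  have "(10 :: nat) ^ m = 10 * 10 ^ (m - 1)" using m(1) by (cases m) auto
  also have "\<dots> \<le> 10 * n ^ (m - 1)" using n by (intro mult_le_mono2 power_mono) auto
  finally have 3: "10 ^ m \<le> 10 * n ^ (m - 1)" .
  have "Suc n ^ c * (\<Sum>i\<le>m. (4 * Suc n + 1) ^ i) \<le> (2 ^ m * n ^ c) * (2 * (5 * n) ^ m)"
    by (rule mult_le_mono[OF 1 2])
  also have "\<dots> = 2 * (n ^ c * n ^ m) * (2 * 5) ^ m"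
    by (simp only: power_mult_distrib mult_ac)
  also have "\<dots> \<le> 2 * (n ^ c * n ^ m) * (10 * n ^ (m - 1))"
    using 3 by (intro mult_le_mono2) simp
  also have "\<dots> = 20 * n ^ (2 * c * d + c - 1)"
    unfolding expo power_add by simp
  finally have 4: "Suc n ^ c * (\<Sum>i\<le>m. (4 * Suc n + 1) ^ i) \<le> 20 * n ^ (2 * c * d + c - 1)" .
  have "n \<le> n ^ (2 * c * d + c - 1)"
    using n m assms unfolding expo by (intro self_le_power) auto
  also have "\<dots> \<le> s * n ^ (2 * c * d + c - 1)" using s by simp
  finally have "n + (s + 1) * (Suc n ^ c * (\<Sum>i\<le>m. (4 * Suc n + 1) ^ i))
      \<le> s * n ^ (2 * c * d + c - 1) + (2 * s) * (20 * n ^ (2 * c * d + c - 1))"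
    using s by (intro add_mono mult_le_mono[OF _ 4]) auto
  then show ?thesis by (simp add: m_def)
qed

section \<open>Few bits, and the final bound\<close>

text \<open>A partial function is determined by its two fibres, which are subsets of a finite cube.
  This makes the sum over all functions in the final constant finite.\<close>

lemma finite_partial_boolfuns: "finite {f. zeros f \<subseteq> cube n \<and> ones f \<subseteq> cube n}"
proof (rule inj_on_finite)
  show "inj_on (\<lambda>f. (zeros f, ones f)) {f. zeros f \<subseteq> cube n \<and> ones f \<subseteq> cube n}"
  proof (rule inj_onI, rule ext)
    fix f g :: partial_boolfun and x
    assume "(zeros f, ones f) = (zeros g, ones g)"
    then have "f x = Some b \<longleftrightarrow> g x = Some b" for b
      by (cases b) (auto simp: zeros_def ones_def set_eq_iff)
    then show "f x = g x" by (metis not_Some_eq)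
  qed
  show "(\<lambda>f. (zeros f, ones f)) ` {f. zeros f \<subseteq> cube n \<and> ones f \<subseteq> cube n}
      \<subseteq> Pow (cube n) \<times> Pow (cube n)" by auto
  show "finite (Pow (cube n) \<times> Pow (cube n))" by (simp add: card_cube)
qed

text \<open>If no such protocol exists, the value is an unspecified natural number; in the final
  constant it can then only add to an upper bound.\<close>

definition min_size :: "nat \<Rightarrow> partial_boolfun \<Rightarrow> nat" where
  "min_size n f = (LEAST k. \<exists>Q :: nat protocol. equality_protocol n 2 Q \<and> solves Q f \<and> protocol_size Q = k)"

theorem theorem2:
  "\<exists>c0 :: real. c0 > 0 \<and>
     (\<forall>(n::nat) (d::nat) (c::nat) (f :: partial_boolfun) (P :: 'v protocol).
        n \<ge> 1 \<longrightarrow> d \<ge> 1 \<longrightarrow> c \<ge> 1 \<longrightarrow> partial_monotone n f \<longrightarrow>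
        conj_ineq_protocol n d c P \<longrightarrow> solves P f \<longrightarrow>
        (\<exists>Q :: nat protocol. equality_protocol n 2 Q \<and> solves Q f \<and>
           real (protocol_size Q) \<le>
             c0 * (real (protocol_size P) * real n ^ (2 * c * d + c - 1)) + c0))"
proof -
  let ?S = "\<lambda>n. {f. zeros f \<subseteq> cube n \<and> ones f \<subseteq> cube n}"
  \<comment> \<open>The 41 serves \<open>n >= 10\<close>. For smaller \<open>n\<close> a factor
    exponential in \<open>c * d\<close> cannot be absorbed by the power of \<open>n\<close>, so the
    sum bounds the minimal sizes instead, which depend only on \<open>n\<close> and
    \<open>f\<close>.\<close>
  define c0 where "c0 = 41 + (\<Sum>n<10. \<Sum>f\<in>?S n. min_size n f)"
  have main: "\<exists>Q :: nat protocol. equality_protocol n 2 Q \<and> solves Q f \<and>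
      protocol_size Q \<le> c0 * (protocol_size P * n ^ (2 * c * d + c - 1)) + c0"
    if assms: "n \<ge> 1" "d \<ge> 1" "c \<ge> 1" "partial_monotone n f" "conj_ineq_protocol n d c P"
      "solves P f"
    for n d c f and P :: "'v protocol"
  proof -
    obtain Q :: "nat protocol" where Q: "equality_protocol n 2 Q" "solves Q f"
      "protocol_size Q \<le> n + (protocol_size P + 1) * (Suc n ^ c * (\<Sum>i\<le>c * d. (4 * Suc n + 1) ^ i))"
      using equality_protocol_of_conj_ineq[OF assms(1,2,4-6)] by blast
    show ?thesis
    proof (cases "n \<ge> 10")
      case True
      have "finite (verts P)" "verts P \<noteq> {}"
        using assms(5) by (auto simp: conj_ineq_protocol_def is_protocol_def is_source_def)
      then have "protocol_size P \<ge> 1" by (simp add: protocol_size_def Suc_le_eq card_gt_0_iff)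
      then have "protocol_size Q \<le> 41 * (protocol_size P * n ^ (2 * c * d + c - 1))"
        using Q(3) size_bound[OF True assms(2,3)] le_trans by blast
      also have "\<dots> \<le> c0 * (protocol_size P * n ^ (2 * c * d + c - 1))"
        by (intro mult_le_mono1) (simp add: c0_def)
      finally show ?thesis using Q(1,2) by (meson trans_le_add1)
    next
      case False
      have "\<exists>R :: nat protocol. equality_protocol n 2 R \<and> solves R f \<and> protocol_size R = min_size n f"
        \<comment> \<open>The protocol \<open>Q\<close>, whatever its size, ensures that the minimum
          is attained.\<close>
        unfolding min_size_def by (rule LeastI_ex) (use Q in blast)
      then obtain R :: "nat protocol"
        where R: "equality_protocol n 2 R" "solves R f" "protocol_size R = min_size n f" by blast
      have "f \<in> ?S n" using assms(4) by (simp add: partial_monotone_def)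
      then have "min_size n f \<le> (\<Sum>f\<in>?S n. min_size n f)"
        by (intro member_le_sum finite_partial_boolfuns) auto
      also have "\<dots> \<le> (\<Sum>n<10. \<Sum>f\<in>?S n. min_size n f)"
        using False by (intro member_le_sum[of n "{..<10}" "\<lambda>n. \<Sum>f\<in>?S n. min_size n f"]) auto
      also have "\<dots> \<le> c0" by (simp add: c0_def)
      finally show ?thesis using R by (metis trans_le_add2)
    qed
  qed
  show ?thesis
  proof (intro exI[of _ "real c0"] conjI allI impI)
    have "c0 > 0" by (simp add: c0_def)
    then show "real c0 > 0" by simp
  next
    fix n d c :: nat and f :: partial_boolfun and P :: "'v protocol"
    assume "n \<ge> 1" "d \<ge> 1" "c \<ge> 1" "partial_monotone n f" "conj_ineq_protocol n d c P" "solves P f"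
    from main[OF this] obtain Q :: "nat protocol" where Q: "equality_protocol n 2 Q" "solves Q f"
      "protocol_size Q \<le> c0 * (protocol_size P * n ^ (2 * c * d + c - 1)) + c0" by blast
    have "real (protocol_size Q) \<le> real (c0 * (protocol_size P * n ^ (2 * c * d + c - 1)) + c0)"
      using Q(3) by (rule of_nat_mono)
    then show "\<exists>Q :: nat protocol. equality_protocol n 2 Q \<and> solves Q f \<and>
        real (protocol_size Q) \<le> real c0 * (real (protocol_size P) * real n ^ (2 * c * d + c - 1)) + real c0"
      using Q(1,2) by (intro exI[of _ Q]) simp
  qed
qed

end
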